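(* Let $R$ be a unital ring and let $S$ be a multiplicative subset of $R$ such that $S\subseteq\mathcal{C}_R$. Then $S$ is a left Ore set of $R$ if and only if $Rs$ is an essential left ideal of $R$ for all $s\in S$, and $S\cap(Rs:r)\neq\emptyset$ for all $s\in S$ and $r\in R$. Furthermore, when these equivalent conditions hold, for all $r\in R$ and $s\in S$ the left ideal $(Rs:r)$ is an essential left ideal of $R$.
   Context: $\mathcal{C}_R$ is the set of regular elements (non-zero-divisors, on both sides) of $R$. A subset $S$ of $R$ is multiplicative if $1\in S$, $SS\subseteq S$, $0\notin S$. A multiplicative set $S$ is a left Ore set if $Sr\cap Rs\neq\emptyset$ for all $r\in R$, $s\in S$. For a left ideal $L$ of $R$ and $r\in R$, $(L:r):=\{r'\in R\mid r'r\in L\}$, a left ideal of $R$. A left ideal is essential if it meets every nonzero left ideal of $R$ nontrivially. *)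

theory Defs
  imports Main
begin

text \<open>
  Rings are unital and not necessarily commutative. The class \<^class>\<open>ring_1\<close> also demands
  \<open>0 \<noteq> 1\<close>; this loses nothing here, because the zero ring has no multiplicative subset.
  The library's modules are over commutative rings and its ideals are two-sided, so left ideals
  are defined directly; closure under negation is the case \<open>r = -1\<close> of closure under left
  multiplication.
\<close>

definition regular_elements :: "'a::ring_1 set"  ("\<C>")
  where "\<C> = {c. (\<forall>x. c * x = 0 \<longrightarrow> x = 0) \<and> (\<forall>x. x * c = 0 \<longrightarrow> x = 0)}"

definition multiplicative :: "'a::ring_1 set \<Rightarrow> bool"
  where "multiplicative S \<longleftrightarrow> 1 \<in> S \<and> (\<forall>s\<in>S. \<forall>t\<in>S. s * t \<in> S) \<and> 0 \<notin> S"

definition right_multiples :: "'a::ring_1 set \<Rightarrow> 'a \<Rightarrow> 'a set"  (infixl "\<cdot>" 75)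
  where "A \<cdot> r = {a * r | a. a \<in> A}"

definition left_ore_set :: "'a::ring_1 set \<Rightarrow> bool"
  where "left_ore_set S \<longleftrightarrow>
    multiplicative S \<and> (\<forall>r. \<forall>s\<in>S. (S \<cdot> r) \<inter> (UNIV \<cdot> s) \<noteq> {})"

definition left_ideal :: "'a::ring_1 set \<Rightarrow> bool"
  where "left_ideal L \<longleftrightarrow>
    0 \<in> L \<and> (\<forall>x\<in>L. \<forall>y\<in>L. x + y \<in> L) \<and> (\<forall>r. \<forall>x\<in>L. r * x \<in> L)"

definition essential_left_ideal :: "'a::ring_1 set \<Rightarrow> bool"
  where "essential_left_ideal L \<longleftrightarrow>
    left_ideal L \<and> (\<forall>J. left_ideal J \<and> J \<noteq> {0} \<longrightarrow> L \<inter> J \<noteq> {0})"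

definition left_quotient :: "'a::ring_1 set \<Rightarrow> 'a \<Rightarrow> 'a set"
  where "left_quotient L r = {r'. r' * r \<in> L}"

end

theory Submission
  imports Defs
begin

text \<open>The Ore condition for r and s says precisely that (Rs:r) meets S, so for multiplicative
  S it is equivalent to the second condition alone; essentiality then follows from regularity
  (\<open>essential_left_idealI\<close>). If every quotient (L:x) meets S, a nonzero x can be moved
  into L by a factor from S without becoming 0. This applies to L = (Rs:r) because (L:x) = (Rs:xr),
  and r = 1 gives Rs itself.\<close>

lemma left_ideal_principal: "left_ideal (UNIV \<cdot> (s::'a::ring_1))"
  unfolding left_ideal_def
proof (intro conjI ballI allI)
  have "0 = 0 * s" by simp
  then show "0 \<in> UNIV \<cdot> s" unfolding right_multiples_def by blast
next
  fix x y assume "x \<in> UNIV \<cdot> s" "y \<in> UNIV \<cdot> s"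
  then obtain a b where "x = a * s" "y = b * s"
    unfolding right_multiples_def by blast
  then have "x + y = (a + b) * s" by (simp add: distrib_right)
  then show "x + y \<in> UNIV \<cdot> s" unfolding right_multiples_def by blast
next
  fix r x assume "x \<in> UNIV \<cdot> s"
  then obtain a where "x = a * s" unfolding right_multiples_def by blast
  then have "r * x = (r * a) * s" by (simp add: mult.assoc)
  then show "r * x \<in> UNIV \<cdot> s" unfolding right_multiples_def by blast
qed

lemma left_ideal_left_quotient:
  assumes "left_ideal L"
  shows "left_ideal (left_quotient L r)"
  using assms unfolding left_ideal_def left_quotient_def
  by (auto simp: distrib_right mult.assoc)

lemma left_quotient_one [simp]: "left_quotient L 1 = L"
  by (simp add: left_quotient_def)

text \<open>Quotients of a quotient of L are again quotients of L, so a property shared by all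
  quotients of L passes to those of (L:r).\<close>

lemma left_quotient_left_quotient: "left_quotient (left_quotient L r) x = left_quotient L (x * r)"
  by (simp add: left_quotient_def mult.assoc)

text \<open>Both sides say that a * r lies in L for some a in S. With L = Rs the left side is the
  Ore condition.\<close>

lemma right_multiples_meet_iff:
  "(S \<cdot> r) \<inter> L \<noteq> {} \<longleftrightarrow> S \<inter> left_quotient L r \<noteq> {}"
  unfolding right_multiples_def left_quotient_def by blast

lemma essential_left_idealI:
  assumes "left_ideal L" and "S \<subseteq> \<C>"
    and meets: "\<And>r. S \<inter> left_quotient L r \<noteq> {}"
  shows "essential_left_ideal L"
  unfolding essential_left_ideal_def
proof (intro conjI allI impI)
  fix J :: "'a set" assume J: "left_ideal J \<and> J \<noteq> {0}"
  then obtain x where x: "x \<in> J" "x \<noteq> 0"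
    unfolding left_ideal_def by blast
  obtain s where s: "s \<in> S" "s * x \<in> L"
    using meets[of x] unfolding left_quotient_def by blast
  \<comment> \<open>Regularity of s enters here: s * x = 0 would force x = 0.\<close>
  have "s * x \<noteq> 0" using s(1) x(2) assms(2) unfolding regular_elements_def by blast
  moreover have "s * x \<in> J" using J x(1) unfolding left_ideal_def by blast
  ultimately show "L \<inter> J \<noteq> {0}" using s(2) by blast
qed (fact assms(1))

theorem corollary2p6:
  fixes S :: "'a::ring_1 set"
  assumes "multiplicative S"
    and "S \<subseteq> \<C>"
  shows "(left_ore_set S \<longleftrightarrow>
            (\<forall>s\<in>S. essential_left_ideal (UNIV \<cdot> s)) \<and>
            (\<forall>s\<in>S. \<forall>r. S \<inter> left_quotient (UNIV \<cdot> s) r \<noteq> {})) \<and>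
         (left_ore_set S \<longrightarrow>
            (\<forall>r. \<forall>s\<in>S. essential_left_ideal (left_quotient (UNIV \<cdot> s) r)))"
proof -
  have ore_iff: "left_ore_set S \<longleftrightarrow> (\<forall>s\<in>S. \<forall>r. S \<inter> left_quotient (UNIV \<cdot> s) r \<noteq> {})"
    using assms(1) unfolding left_ore_set_def right_multiples_meet_iff by blast
  have essential: "essential_left_ideal (left_quotient (UNIV \<cdot> s) r)"
    if "left_ore_set S" "s \<in> S" for r s
  proof (rule essential_left_idealI[OF _ assms(2)])
    show "left_ideal (left_quotient (UNIV \<cdot> s) r)"
      by (intro left_ideal_left_quotient left_ideal_principal)
    \<comment> \<open>This is the Ore condition for s and the ring element x * r.\<close>
    show "S \<inter> left_quotient (left_quotient (UNIV \<cdot> s) r) x \<noteq> {}" for x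
      using that ore_iff unfolding left_quotient_left_quotient by blast
  qed
  have "essential_left_ideal (UNIV \<cdot> s)" if "left_ore_set S" "s \<in> S" for s
    \<comment> \<open>Rs is the quotient (Rs:1).\<close>
    using essential[OF that, of 1] by simp
  with ore_iff essential show ?thesis by blast
qed

end
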